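(* Let $q$ be the committor function of the overdamped Langevin process with potential $V$ relative to the sets $A$ and $B$, i.e. $q(\mathbf{x})=\mathbb{P}(\tau_B<\tau_A\mid \mathbf{x}_0=\mathbf{x})$, which is the solution of $$\left(-\tfrac{1}{\beta}\Delta+\nabla V\cdot\nabla\right)q=0\ \text{ in }\ \Omega\setminus(A\cup B),\qquad q|_{\partial A}=0,\qquad q|_{\partial B}=1 .$$ Fix $\delta>0$ and let $(Pf)(\mathbf{x}):=\mathbb{E}^{\mathbf{x}}\left(f(\mathbf{x}_{\tau\wedge\delta})\right)$. If $\nabla V$ is bounded and Lipschitz continuous on $\mathbb{R}^d$, then $q$ satisfies $$q(\mathbf{x})=(Pq)(\mathbf{x})\ \text{ in }\ \Omega\setminus(A\cup B),\qquad q|_{\partial A}=0,\qquad q|_{\partial B}=1 .$$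
   Context: Setting. $\Omega\subset\mathbb{R}^d$ is the state space, $V:\mathbb{R}^d\to\mathbb{R}$ is a smooth potential, $\beta>0$ is the inverse temperature, and $A,B\subset\Omega$ are two given simply connected domains with smooth boundaries. The overdamped Langevin process started at $\mathbf{x}\in\Omega$ is the solution, with values $\mathbf{x}_t\in\Omega$, of $$d\mathbf{x}_t=-\nabla V(\mathbf{x}_t)\,dt+\sqrt{2\beta^{-1}}\,d\mathbf{w}_t,\qquad \mathbf{x}_0=\mathbf{x},$$ where $\mathbf{w}_t$ is standard $d$-dimensional Brownian motion. $\mathbb{E}^{\mathbf{x}}$ denotes expectation with respect to the law of this process. $\tau_A$ and $\tau_B$ are the hitting times of $A$ and $B$ (equivalently, for the process started outside $A\cup B$, of $\partial A$ and $\partial B$), $\tau:=\tau_{A\cup B}=\min(\tau_A,\tau_B)$ is the hitting time of $A\cup B$, and $\tau\wedge\delta=\min(\tau,\delta)$. Standing assumption: $V$ is confining, i.e. $V(\mathbf{x})\to\infty$ as $|\mathbf{x}|\to\infty$ and $Z_\beta=\int_{\mathbb{R}^d}e^{-\beta V(\mathbf{x})}\,d\mathbf{x}<\infty$ for every $\beta>0$. *)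

theory Defs
  imports "HOL-Probability.Probability"
begin

definition partial :: "'a::euclidean_space \<Rightarrow> ('a \<Rightarrow> real) \<Rightarrow> 'a \<Rightarrow> real" where
  "partial b f x = frechet_derivative f (at x) b"

definition gradient :: "('a::euclidean_space \<Rightarrow> real) \<Rightarrow> 'a \<Rightarrow> 'a" where
  "gradient f x = (\<Sum>b\<in>Basis. partial b f x *\<^sub>R b)"

definition laplacian :: "('a::euclidean_space \<Rightarrow> real) \<Rightarrow> 'a \<Rightarrow> real" where
  "laplacian f x = (\<Sum>b\<in>Basis. partial b (partial b f) x)"

text \<open>Meant for open \<open>S\<close>: the partial derivatives of order at most \<open>k\<close> exist
  and are continuous on \<open>S\<close>.\<close>

primrec C_on :: "nat \<Rightarrow> 'a::euclidean_space set \<Rightarrow> ('a \<Rightarrow> real) \<Rightarrow> bool" where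
  "C_on 0 S f \<longleftrightarrow> continuous_on S f"
| "C_on (Suc k) S f \<longleftrightarrow>
     (\<forall>x\<in>S. f differentiable (at x)) \<and> (\<forall>b\<in>Basis. C_on k S (partial b f))"

definition smooth_on :: "'a::euclidean_space set \<Rightarrow> ('a \<Rightarrow> real) \<Rightarrow> bool" where
  "smooth_on S f \<longleftrightarrow> (\<forall>k. C_on k S f)"

text \<open>Near each boundary point, \<open>A\<close> is the negativity set of a smooth function with
  non-vanishing gradient, so \<open>A\<close> lies locally on one side of the hypersurface
  \<open>frontier A\<close>.\<close>

definition smooth_boundary :: "'a::euclidean_space set \<Rightarrow> bool" where
  "smooth_boundary A \<longleftrightarrow>
     (\<forall>p\<in>frontier A. \<exists>U \<rho>. open U \<and> p \<in> U \<and> smooth_on U \<rho> \<and>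
        (\<forall>y\<in>U. gradient \<rho> y \<noteq> 0) \<and> A \<inter> U = {y\<in>U. \<rho> y < 0})"

text \<open>Connectedness is part of \<open>simply_connected\<close>.\<close>

definition smooth_simply_connected_domain :: "'a::euclidean_space set \<Rightarrow> bool" where
  "smooth_simply_connected_domain A \<longleftrightarrow>
     open A \<and> A \<noteq> {} \<and> simply_connected A \<and> smooth_boundary A"

definition confining :: "('a::euclidean_space \<Rightarrow> real) \<Rightarrow> bool" where
  "confining V \<longleftrightarrow> filterlim V at_top at_infinity \<and>
     (\<forall>\<beta>>0. integrable lborel (\<lambda>x. exp (- \<beta> * V x)))"

text \<open>The increment over \<open>{s..t}\<close> has distribution \<open>N(0, (t - s) I)\<close>. An arbitrary
  increasing sequence \<open>r\<close> of times is used in the independence clause; finite partitions are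
  covered by eventually constant sequences.\<close>

definition brownian_motion ::
  "'w measure \<Rightarrow> (real \<Rightarrow> 'w \<Rightarrow> 'a::euclidean_space) \<Rightarrow> bool" where
  "brownian_motion M W \<longleftrightarrow>
     prob_space M \<and>
     (\<forall>t\<ge>0. W t \<in> borel_measurable M) \<and>
     (AE \<omega> in M. W 0 \<omega> = 0) \<and>
     (\<forall>r. 0 \<le> r 0 \<and> incseq r \<longrightarrow>
        prob_space.indep_vars M (\<lambda>_. borel) (\<lambda>i \<omega>. W (r (Suc i)) \<omega> - W (r i) \<omega>) (UNIV :: nat set)) \<and>
     (\<forall>s t. 0 \<le> s \<and> s < t \<longrightarrow>
        distributed M lborel (\<lambda>\<omega>. W t \<omega> - W s \<omega>)
          (\<lambda>x. ennreal (\<Prod>b\<in>Basis. normal_density 0 (sqrt (t - s)) (x \<bullet> b)))) \<and>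
     (AE \<omega> in M. continuous_on {0..} (\<lambda>t. W t \<omega>))"

text \<open>The noise being additive, the stochastic differential equation
  \<open>dX = - \<nabla>V(X) dt + sqrt (2 / \<beta>) dW\<close>, \<open>X 0 = x\<close>, in integrated form involves no
  stochastic integral other than \<open>W\<close> itself.\<close>

definition langevin_solution ::
  "('a::euclidean_space \<Rightarrow> real) \<Rightarrow> real \<Rightarrow> 'a set \<Rightarrow> 'w measure \<Rightarrow> (real \<Rightarrow> 'w \<Rightarrow> 'a) \<Rightarrow>
   'a \<Rightarrow> (real \<Rightarrow> 'w \<Rightarrow> 'a) \<Rightarrow> bool" where
  "langevin_solution V \<beta> \<Omega> M W x X \<longleftrightarrow>
     (\<forall>t\<ge>0. X t \<in> borel_measurable M) \<and>
     (AE \<omega> in M. continuous_on {0..} (\<lambda>t. X t \<omega>) \<and>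
        (\<forall>t\<ge>0. X t \<omega> \<in> \<Omega> \<and>
           X t \<omega> = x - integral {0..t} (\<lambda>s. gradient V (X s \<omega>)) + sqrt (2 / \<beta>) *\<^sub>R W t \<omega>))"

text \<open>The value is \<open>\<infinity>\<close> if the path \<open>y\<close> never meets \<open>S\<close>.\<close>

definition hitting_time :: "'a set \<Rightarrow> (real \<Rightarrow> 'a) \<Rightarrow> ereal" where
  "hitting_time S y = Inf (ereal ` {t. 0 \<le> t \<and> y t \<in> S})"

text \<open>Below, \<open>X x\<close> is the process started at \<open>x\<close>. Since path properties are only required
  almost surely, events and random variables built from whole paths are determined up to null
  sets; the completion of \<open>M\<close> makes their probabilities and expectations meaningful.\<close>

definition hitting_probability ::
  "'w measure \<Rightarrow> ('a \<Rightarrow> real \<Rightarrow> 'w \<Rightarrow> 'a) \<Rightarrow> 'a set \<Rightarrow> 'a set \<Rightarrow> 'a \<Rightarrow> real" where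
  "hitting_probability M X A B x =
     measure (completion M)
       {\<omega>\<in>space M. hitting_time B (\<lambda>t. X x t \<omega>) < hitting_time A (\<lambda>t. X x t \<omega>)}"

definition stopped_semigroup ::
  "'w measure \<Rightarrow> ('a \<Rightarrow> real \<Rightarrow> 'w \<Rightarrow> 'a) \<Rightarrow> 'a set \<Rightarrow> 'a set \<Rightarrow> real \<Rightarrow> ('a \<Rightarrow> real) \<Rightarrow> 'a \<Rightarrow> real" where
  "stopped_semigroup M X A B \<delta> f x =
     (\<integral>\<omega>. f (X x (real_of_ereal (min (hitting_time (A \<union> B) (\<lambda>t. X x t \<omega>)) (ereal \<delta>))) \<omega>)
        \<partial>(completion M))"

text \<open>Classical solutions: \<open>A\<close> and \<open>B\<close> being open, the region \<open>\<Omega> - (A \<union> B)\<close> contains boundary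
  points of \<open>A\<close> and \<open>B\<close>, so the differential equation is imposed on its interior, and
  \<open>q\<close> is continuous up to the boundaries of \<open>A\<close> and \<open>B\<close>.\<close>

definition solves_committor_equation ::
  "('a::euclidean_space \<Rightarrow> real) \<Rightarrow> real \<Rightarrow> 'a set \<Rightarrow> 'a set \<Rightarrow> 'a set \<Rightarrow> ('a \<Rightarrow> real) \<Rightarrow> bool" where
  "solves_committor_equation V \<beta> \<Omega> A B q \<longleftrightarrow>
     C_on 2 (interior (\<Omega> - (A \<union> B))) q \<and>
     continuous_on ((\<Omega> - (A \<union> B)) \<union> frontier A \<union> frontier B) q \<and>
     (\<forall>x\<in>interior (\<Omega> - (A \<union> B)).
        - (1 / \<beta>) * laplacian q x + gradient V x \<bullet> gradient q x = 0) \<and>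
     (\<forall>x\<in>frontier A. q x = 0) \<and>
     (\<forall>x\<in>frontier B. q x = 1)"

definition is_committor ::
  "('a::euclidean_space \<Rightarrow> real) \<Rightarrow> real \<Rightarrow> 'a set \<Rightarrow> 'a set \<Rightarrow> 'a set \<Rightarrow>
   'w measure \<Rightarrow> ('a \<Rightarrow> real \<Rightarrow> 'w \<Rightarrow> 'a) \<Rightarrow> ('a \<Rightarrow> real) \<Rightarrow> bool" where
  "is_committor V \<beta> \<Omega> A B M X q \<longleftrightarrow>
     (\<forall>x\<in>\<Omega>. q x = hitting_probability M X A B x) \<and>
     solves_committor_equation V \<beta> \<Omega> A B q"

end

theory Submission
  imports Defs
begin

text \<open>
  Write \<open>\<tau>\<close> for the hitting time of \<open>A \<union> B\<close> and split according to whether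
  \<open>\<tau> < \<delta>\<close>.

  If \<open>\<tau> < \<delta>\<close>, the process is stopped on the frontier of \<open>A\<close> or of
  \<open>B\<close>. These frontiers are disjoint because \<open>q\<close> is \<open>0\<close> on the one and
  \<open>1\<close> on the other, so the frontier that is reached tells which set is hit first
  (\<open>first_hit_frontier\<close>): \<open>q\<close> at the stopped position is the indicator of the event that
  \<open>B\<close> is hit before \<open>A\<close>. This holds path by path.

  If \<open>\<delta> \<le> \<tau>\<close>, the process is stopped at the fixed time \<open>\<delta>\<close>, and the path after
  \<open>\<delta>\<close> decides which set is hit first. By the Markov property at \<open>\<delta>\<close>, the conditional
  probability that it is \<open>B\<close> is the hitting probability from the position at \<open>\<delta>\<close>, that
  is, \<open>q\<close> there. Adding the two cases, the expectation of \<open>q\<close> at the stopped position is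
  \<open>P(\<tau>\<^sub>B < \<tau>\<^sub>A) = q x\<close> (\<open>visit_probability_markov\<close>).
  So the identity comes from the probabilistic description of \<open>q\<close> and its boundary values, and
  the Markov property is applied at a deterministic time only.

  The Markov property of the process has to be derived from its equation. Since the noise is
  additive, a solution is, path by path, the limit of Euler schemes driven by the increments of
  \<open>W\<close> over the dyadic subdivisions of step \<open>\<delta> / 2 ^ n\<close>
  (\<open>euler_limit_additive_noise_path\<close>). Hence it is a measurable function of its starting point
  and of these increments, and it restarts at \<open>\<delta>\<close> as the same function of its position and of
  the later increments. What remains is the Markov property of the noise: replacing the increments
  after \<open>\<delta>\<close> by those of an independent copy does not change the joint law
  (\<open>brownian_concatenation\<close>). On each dyadic level the increments are i.i.d., where this is a
  statement about sequences; and a finer level determines the coarser ones, so the levels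
  together give the joint law (\<open>distr_eq_if_levels_refine\<close>).

  Whether \<open>B\<close> is hit before \<open>A\<close> depends on the whole path, but as both sets are open it
  can be read off from the values at dyadic times (\<open>hitting_time_less_iff_visits_before\<close>), which
  makes the event measurable.
\<close>

section \<open>Euler schemes for equations with additive noise\<close>

primrec euler_scheme ::
  "('a \<Rightarrow> 'a) \<Rightarrow> real \<Rightarrow> real \<Rightarrow> 'a::real_vector \<Rightarrow> (nat \<Rightarrow> 'a) \<Rightarrow> nat \<Rightarrow> 'a" where
  "euler_scheme G c h z \<xi> 0 = z"
| "euler_scheme G c h z \<xi> (Suc k) =
     euler_scheme G c h z \<xi> k - h *\<^sub>R G (euler_scheme G c h z \<xi> k) + c *\<^sub>R \<xi> k"

lemma euler_scheme_cong:
  assumes "\<And>j. j < k \<Longrightarrow> \<xi> j = \<eta> j"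
  shows "euler_scheme G c h z \<xi> k = euler_scheme G c h z \<eta> k"
  using assms by (induction k) auto

text \<open>Stating the equation through increments makes it invariant under time shifts of
  \<open>y\<close> and \<open>w\<close>.\<close>

definition additive_noise_path ::
  "('a \<Rightarrow> 'a) \<Rightarrow> real \<Rightarrow> (real \<Rightarrow> 'a) \<Rightarrow> (real \<Rightarrow> 'a::euclidean_space) \<Rightarrow> bool" where
  "additive_noise_path G c w y \<longleftrightarrow>
     continuous_on {0..} y \<and>
     (\<forall>s t. 0 \<le> s \<and> s \<le> t \<longrightarrow>
        y t - y s = c *\<^sub>R (w t - w s) - integral {s..t} (\<lambda>r. G (y r)))"

lemma additive_noise_path_shift:
  assumes "additive_noise_path G c w y" "continuous_on UNIV G" "0 \<le> a"
  shows "additive_noise_path G c (\<lambda>t. w (a + t)) (\<lambda>t. y (a + t))"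
proof -
  have y: "continuous_on {0..} y"
    using assms(1) by (simp add: additive_noise_path_def)
  have Gy: "continuous_on {0..} (\<lambda>r. G (y r))"
    by (rule continuous_on_compose2[OF assms(2) y]) auto
  have "y (a + t) - y (a + s) = c *\<^sub>R (w (a + t) - w (a + s)) - integral {s..t} (\<lambda>r. G (y (a + r)))"
    if "0 \<le> s" "s \<le> t" for s t
  proof -
    have "integral {s..t} ((\<lambda>r. G (y r)) \<circ> (\<lambda>r. r + a)) = integral {s + a..t + a} (\<lambda>r. G (y r))"
      using that assms(3) by (intro integral_shift continuous_on_subset[OF Gy]) auto
    moreover have "y (a + t) - y (a + s) =
        c *\<^sub>R (w (a + t) - w (a + s)) - integral {a + s..a + t} (\<lambda>r. G (y r))"
      using assms(1,3) that by (simp add: additive_noise_path_def)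
    ultimately show ?thesis
      by (simp add: o_def add.commute)
  qed
  moreover have "continuous_on {0..} (\<lambda>t. y (a + t))"
    by (rule continuous_on_compose2[OF y]) (use assms(3) in \<open>auto intro!: continuous_intros\<close>)
  ultimately show ?thesis
    by (simp add: additive_noise_path_def)
qed

text \<open>Over one step the exact path and the scheme receive the same noise, so they differ only in
  the drift, by at most \<open>h L (\<epsilon> + d)\<close> when \<open>\<epsilon>\<close> bounds the oscillation of the path and
  \<open>d\<close> is the current error. The bound below is the solution of the resulting recursion.\<close>

lemma euler_scheme_error:
  fixes G :: "'a::euclidean_space \<Rightarrow> 'a"
  assumes G: "L-lipschitz_on UNIV G" and h: "0 \<le> h" and y: "additive_noise_path G c w y"
    and osc: "\<And>s t. 0 \<le> s \<Longrightarrow> s \<le> t \<Longrightarrow> t \<le> real K * h \<Longrightarrow> t - s \<le> h \<Longrightarrow> norm (y t - y s) \<le> \<epsilon>"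
  shows "k \<le> K \<Longrightarrow>
    norm (y (real k * h) -
      euler_scheme G c h (y 0) (\<lambda>j. w (real (Suc j) * h) - w (real j * h)) k)
      \<le> \<epsilon> * ((1 + h * L) ^ k - 1)"
proof (induction k)
  case 0
  then show ?case by simp
next
  case (Suc k)
  define e where "e = euler_scheme G c h (y 0) (\<lambda>j. w (real (Suc j) * h) - w (real j * h))"
  define s t where "s = real k * h" and "t = real (Suc k) * h"
  define d where "d = norm (y s - e k)"
  have L: "0 \<le> L" using G by (simp add: lipschitz_on_def)
  have st: "0 \<le> s" "s \<le> t" "t - s = h"
    using h by (auto simp: s_def t_def algebra_simps)
  have "t \<le> real K * h"
    using Suc.prems h unfolding t_def by (intro mult_right_mono) auto
  have Gcont: "continuous_on UNIV G"
    using G lipschitz_on_continuous_on by blast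
  have y_st: "continuous_on {s..t} y"
    using y st by (auto simp: additive_noise_path_def elim: continuous_on_subset)
  have Gy: "continuous_on {s..t} (\<lambda>r. G (y r))"
    by (rule continuous_on_compose2[OF Gcont y_st]) auto
  have drift: "norm (G (y r) - G (e k)) \<le> L * (\<epsilon> + d)" if "r \<in> {s..t}" for r
  proof -
    have "norm (y r - e k) \<le> norm (y r - y s) + norm (y s - e k)"
      by (metis diff_add_cancel add_diff_eq norm_triangle_ineq)
    also have "\<dots> \<le> \<epsilon> + d"
      using osc[of s r] that st \<open>t \<le> real K * h\<close> by (auto simp: d_def)
    finally have "L * norm (y r - e k) \<le> L * (\<epsilon> + d)"
      using L by (rule mult_left_mono)
    moreover have "norm (G (y r) - G (e k)) \<le> L * norm (y r - e k)"
      using lipschitz_onD[OF G] by (simp add: dist_norm)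
    ultimately show ?thesis by linarith
  qed
  have exact: "y t - y s = c *\<^sub>R (w t - w s) - integral {s..t} (\<lambda>r. G (y r))"
    using y st by (simp add: additive_noise_path_def)
  have step: "e (Suc k) = e k - h *\<^sub>R G (e k) + c *\<^sub>R (w t - w s)"
    by (simp add: e_def s_def t_def)
  have diff: "integral {s..t} (\<lambda>r. G (y r) - G (e k)) =
      integral {s..t} (\<lambda>r. G (y r)) - h *\<^sub>R G (e k)"
    using st by (subst integral_diff) (auto intro!: integrable_continuous_interval Gy)
  have "y t - e (Suc k) = (y t - y s) + y s - e (Suc k)"
    by simp
  also have "\<dots> = (y s - e k) - integral {s..t} (\<lambda>r. G (y r) - G (e k))"
    unfolding exact step diff by simp
  finally have "norm (y t - e (Suc k)) \<le> d + norm (integral {s..t} (\<lambda>r. G (y r) - G (e k)))"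
    unfolding d_def by (metis norm_triangle_ineq4)
  also have "norm (integral {s..t} (\<lambda>r. G (y r) - G (e k))) \<le> L * (\<epsilon> + d) * (t - s)"
    using st drift by (intro integral_bound) (auto intro!: continuous_intros Gy)
  also have "d + L * (\<epsilon> + d) * (t - s) = (1 + h * L) * d + h * L * \<epsilon>"
    using st by (simp add: algebra_simps)
  also have "\<dots> \<le> (1 + h * L) * (\<epsilon> * ((1 + h * L) ^ k - 1)) + h * L * \<epsilon>"
    using Suc.IH Suc.prems h L by (intro add_right_mono mult_left_mono) (auto simp: d_def e_def s_def)
  also have "\<dots> = \<epsilon> * ((1 + h * L) ^ Suc k - 1)"
    by (simp add: algebra_simps)
  finally show ?case
    by (simp only: e_def t_def)
qed

definition dyadic_time :: "real \<Rightarrow> nat \<times> nat \<Rightarrow> real" where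
  "dyadic_time \<delta> = (\<lambda>(m, k). real k * \<delta> / 2 ^ m)"

definition dyadic_increments :: "real \<Rightarrow> (real \<Rightarrow> 'a::minus) \<Rightarrow> nat \<Rightarrow> nat \<Rightarrow> 'a" where
  "dyadic_increments \<delta> w n k = w (dyadic_time \<delta> (n, Suc k)) - w (dyadic_time \<delta> (n, k))"

text \<open>At level \<open>n\<close> the scheme has step \<open>\<delta> / 2 ^ n\<close> and is driven by \<open>u n\<close>; for
  \<open>n \<ge> m\<close> its step number \<open>k * 2 ^ (n - m)\<close> lies at time \<open>dyadic_time \<delta> (m, k)\<close>.\<close>

definition euler_limit ::
  "('a \<Rightarrow> 'a) \<Rightarrow> real \<Rightarrow> real \<Rightarrow> 'a::real_normed_vector \<Rightarrow> (nat \<Rightarrow> nat \<Rightarrow> 'a) \<Rightarrow> nat \<times> nat \<Rightarrow> 'a" where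
  "euler_limit G c \<delta> z u =
     (\<lambda>(m, k). lim (\<lambda>n. euler_scheme G c (\<delta> / 2 ^ n) z (u n) (k * 2 ^ (n - m))))"

text \<open>Besides measurability in the initial value and the noise, convergence gives uniqueness: the
  path is a function of its initial value and of the noise increments.\<close>

lemma euler_limit_additive_noise_path:
  fixes G :: "'a::euclidean_space \<Rightarrow> 'a"
  assumes G: "L-lipschitz_on UNIV G" and y: "additive_noise_path G c w y" and \<delta>: "0 < \<delta>"
  shows "euler_limit G c \<delta> (y 0) (dyadic_increments \<delta> w) i = y (dyadic_time \<delta> i)"
proof -
  obtain m k where i: "i = (m, k)" by fastforce
  define T where "T = dyadic_time \<delta> (m, k)"
  define E where "E n = euler_scheme G c (\<delta> / 2 ^ n) (y 0) (dyadic_increments \<delta> w n) (k * 2 ^ (n - m))" for n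
  have L: "0 \<le> L" using G by (simp add: lipschitz_on_def)
  have "continuous_on {0..T} y"
    using y by (auto simp: additive_noise_path_def elim: continuous_on_subset)
  then have unif: "uniformly_continuous_on {0..T} y"
    by (rule compact_uniformly_continuous) simp
  have "E \<longlonglongrightarrow> y T"
  proof (rule LIMSEQ_I)
    fix r :: real assume r: "0 < r"
    \<comment> \<open>the error bound \<open>\<epsilon> * ((1 + h * L) ^ K - 1)\<close> at time \<open>K * h = T\<close> is below
        \<open>\<epsilon> * exp (L * T)\<close>, uniformly in the step\<close>
    define \<epsilon> where "\<epsilon> = r / exp (L * T)"
    have \<epsilon>: "0 < \<epsilon>" using r by (simp add: \<epsilon>_def)
    obtain d where d: "0 < d"
      "\<And>s t. s \<in> {0..T} \<Longrightarrow> t \<in> {0..T} \<Longrightarrow> dist s t < d \<Longrightarrow> dist (y s) (y t) < \<epsilon>"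
      using unif \<epsilon> unfolding uniformly_continuous_on_def by metis
    have "(\<lambda>n. \<delta> * (1 / 2) ^ n) \<longlonglongrightarrow> 0"
      by (intro tendsto_mult_right_zero LIMSEQ_realpow_zero) auto
    then have "\<forall>\<^sub>F n in sequentially. \<delta> * (1 / 2) ^ n < d"
      using d(1) by (rule order_tendstoD)
    then obtain N where N: "\<And>n. n \<ge> N \<Longrightarrow> \<delta> / 2 ^ n < d"
      by (auto simp: eventually_sequentially power_divide)
    have "norm (E n - y T) < r" if n: "n \<ge> max N m" for n
    proof -
      define h K where "h = \<delta> / 2 ^ n" and "K = k * 2 ^ (n - m)"
      have h: "0 < h" "h < d" using \<delta> N n by (auto simp: h_def)
      have "(2::real) ^ n = 2 ^ m * 2 ^ (n - m)"
        using n by (simp flip: power_add)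
      then have T: "real K * h = T"
        by (simp add: T_def K_def h_def dyadic_time_def)
      have "norm (y (real K * h) -
          euler_scheme G c h (y 0) (\<lambda>j. w (real (Suc j) * h) - w (real j * h)) K)
          \<le> \<epsilon> * ((1 + h * L) ^ K - 1)"
      proof (rule euler_scheme_error[OF G _ y])
        fix s t :: real assume "0 \<le> s" "s \<le> t" "t \<le> real K * h" "t - s \<le> h"
        then have "dist (y t) (y s) < \<epsilon>"
          using h by (intro d(2)) (auto simp: T dist_real_def)
        then show "norm (y t - y s) \<le> \<epsilon>" by (simp add: dist_norm)
      qed (use h in auto)
      moreover have "(\<lambda>j. w (real (Suc j) * h) - w (real j * h)) = dyadic_increments \<delta> w n"
        by (simp add: fun_eq_iff dyadic_increments_def dyadic_time_def h_def)
      ultimately have "norm (y T - E n) \<le> \<epsilon> * ((1 + h * L) ^ K - 1)"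
        unfolding E_def T[symmetric] by (simp add: h_def K_def)
      also have "(1 + h * L) ^ K \<le> exp (h * L) ^ K"
        using h L by (intro power_mono) auto
      also have "exp (h * L) ^ K = exp (L * T)"
        by (simp add: T[symmetric] exp_of_nat_mult[symmetric] mult_ac)
      also have "\<epsilon> * (exp (L * T) - 1) < r"
        using \<epsilon> by (simp add: \<epsilon>_def right_diff_distrib)
      finally show ?thesis
        using \<epsilon> by (simp add: norm_minus_commute mult_left_mono)
    qed
    then show "\<exists>no. \<forall>n\<ge>no. norm (E n - y T) < r" by blast
  qed
  then show ?thesis
    by (simp add: limI i euler_limit_def T_def flip: E_def)
qed

text \<open>On the levels \<open>n < m\<close> the sequence behind the limit evaluates the scheme at step
  \<open>k\<close>, which may lie after \<open>\<delta>\<close>; these finitely many terms do not affect the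
  limit.\<close>

lemma euler_limit_cong_past:
  assumes uv: "\<And>n k. k < 2 ^ n \<Longrightarrow> u n k = v n k" and i: "dyadic_time \<delta> i \<le> \<delta>" and \<delta>: "0 < \<delta>"
  shows "euler_limit G c \<delta> z u i = euler_limit G c \<delta> z v i"
proof -
  obtain m k where mk: "i = (m, k)" by fastforce
  have "real k \<le> 2 ^ m"
    using i \<delta> by (simp add: mk dyadic_time_def field_simps)
  then have k: "k \<le> 2 ^ m"
    by simp
  have "\<forall>\<^sub>F n in sequentially.
      euler_scheme G c (\<delta> / 2 ^ n) z (u n) (k * 2 ^ (n - m)) =
      euler_scheme G c (\<delta> / 2 ^ n) z (v n) (k * 2 ^ (n - m))"
    using eventually_ge_at_top[of m]
  proof eventually_elim
    case (elim n)
    have "k * 2 ^ (n - m) \<le> 2 ^ m * 2 ^ (n - m)"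
      using k by simp
    also have "\<dots> = 2 ^ n"
      using elim by (simp flip: power_add)
    finally show ?case
      by (intro euler_scheme_cong uv) simp
  qed
  then show ?thesis
    unfolding euler_limit_def mk prod.case lim_def by (simp add: tendsto_cong)
qed

section \<open>The Markov property of Brownian motion at a fixed time\<close>

abbreviation increment_space :: "(nat \<Rightarrow> nat \<Rightarrow> 'a::topological_space) measure" where
  "increment_space \<equiv> \<Pi>\<^sub>M n\<in>UNIV. \<Pi>\<^sub>M k\<in>UNIV. borel"

lemma measurable_increment [measurable]:
  "(\<lambda>u. u n k) \<in> borel_measurable increment_space"
  by (rule measurable_compose[where f = "\<lambda>u. u n" and g = "\<lambda>v. v k" and N = "\<Pi>\<^sub>M k\<in>UNIV. borel"]) auto

text \<open>A finite-dimensional cylinder involves finitely many levels, and the finest of them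
  determines the others; so the laws of the single levels determine the law of the family.\<close>

lemma distr_eq_if_levels_refine:
  assumes f[measurable]: "f \<in> M \<rightarrow>\<^sub>M (\<Pi>\<^sub>M n\<in>UNIV. K)" and g[measurable]: "g \<in> N \<rightarrow>\<^sub>M (\<Pi>\<^sub>M n\<in>UNIV. K)"
    and "prob_space M"
    and C[measurable]: "\<And>n m. n \<le> m \<Longrightarrow> C n m \<in> K \<rightarrow>\<^sub>M K"
    and fC: "\<And>n m \<omega>. n \<le> m \<Longrightarrow> \<omega> \<in> space M \<Longrightarrow> f \<omega> n = C n m (f \<omega> m)"
    and gC: "\<And>n m \<omega>. n \<le> m \<Longrightarrow> \<omega> \<in> space N \<Longrightarrow> g \<omega> n = C n m (g \<omega> m)"
    and level: "\<And>m. distr M K (\<lambda>\<omega>. f \<omega> m) = distr N K (\<lambda>\<omega>. g \<omega> m)"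
  shows "distr M (\<Pi>\<^sub>M n\<in>(UNIV::nat set). K) f = distr N (\<Pi>\<^sub>M n\<in>UNIV. K) g"
proof (rule measure_eqI_PiM_infinite[where I = UNIV and M = "\<lambda>_. K"])
  show "finite_measure (distr M (\<Pi>\<^sub>M n\<in>UNIV. K) f)"
    using \<open>prob_space M\<close> f by (intro prob_space.finite_measure prob_space.prob_space_distr)
next
  fix A and J :: "nat set"
  assume J: "finite J" and A[measurable]: "\<And>i. i \<in> J \<Longrightarrow> A i \<in> sets K"
  \<comment> \<open>the finest level that the cylinder involves; \<open>0\<close> covers the empty \<open>J\<close>\<close>
  define m where "m = Max (insert 0 J)"
  have m: "n \<le> m" if "n \<in> J" for n
    using J that by (simp add: m_def)
  \<comment> \<open>the cylinder, expressed through level \<open>m\<close> alone\<close>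
  define E where "E = {x \<in> space K. \<forall>n\<in>J. C n m x \<in> A n}"
  have [measurable]: "E \<in> sets K"
    unfolding E_def using J m
    by (intro sets.sets_Collect_finite_All) (auto intro!: measurable_sets_Collect[OF C])
  define Z where "Z = prod_emb UNIV (\<lambda>_::nat. K) J (Pi\<^sub>E J A)"
  have [measurable]: "Z \<in> sets (\<Pi>\<^sub>M n\<in>UNIV. K)"
    unfolding Z_def using J A by (intro sets_PiM_I) auto
  have pre: "h -` Z \<inter> space P = (\<lambda>\<omega>. h \<omega> m) -` E \<inter> space P"
    if h[measurable]: "h \<in> P \<rightarrow>\<^sub>M (\<Pi>\<^sub>M n\<in>UNIV. K)"
      and hC: "\<And>n m \<omega>. n \<le> m \<Longrightarrow> \<omega> \<in> space P \<Longrightarrow> h \<omega> n = C n m (h \<omega> m)" for h and P :: "'z measure"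
  proof -
    have "h \<omega> \<in> Z \<longleftrightarrow> h \<omega> m \<in> E" if \<omega>: "\<omega> \<in> space P" for \<omega>
    proof -
      have "h \<omega> n \<in> space K" for n
        using measurable_space[OF h \<omega>] by (simp add: space_PiM PiE_iff)
      moreover have "h \<omega> n = C n m (h \<omega> m)" if "n \<in> J" for n
        using hC[OF m[OF that] \<omega>] .
      ultimately show ?thesis
        by (auto simp: Z_def E_def prod_emb_def PiE_iff)
    qed
    then show ?thesis by auto
  qed
  have "emeasure (distr M (\<Pi>\<^sub>M n\<in>UNIV. K) f) Z = emeasure (distr M K (\<lambda>\<omega>. f \<omega> m)) E"
    by (simp add: emeasure_distr pre[OF f fC])
  also have "\<dots> = emeasure (distr N (\<Pi>\<^sub>M n\<in>UNIV. K) g) Z"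
    unfolding level by (simp add: emeasure_distr pre[OF g gC])
  finally show "emeasure (distr M (\<Pi>\<^sub>M n\<in>UNIV. K) f) (prod_emb UNIV (\<lambda>_. K) J (Pi\<^sub>E J A)) =
      emeasure (distr N (\<Pi>\<^sub>M n\<in>UNIV. K) g) (prod_emb UNIV (\<lambda>_. K) J (Pi\<^sub>E J A))"
    by (simp add: Z_def)
qed simp_all

text \<open>Passage from the increments of level \<open>m\<close> to those of a coarser level \<open>n\<close>.\<close>

definition coarsen :: "nat \<Rightarrow> nat \<Rightarrow> (nat \<Rightarrow> 'a) \<Rightarrow> nat \<Rightarrow> 'a::comm_monoid_add" where
  "coarsen n m u k = (\<Sum>j<2 ^ (m - n). u (k * 2 ^ (m - n) + j))"

lemma measurable_coarsen [measurable]: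
  "(coarsen n m :: (nat \<Rightarrow> 'a::euclidean_space) \<Rightarrow> _) \<in> (\<Pi>\<^sub>M k\<in>UNIV. borel) \<rightarrow>\<^sub>M (\<Pi>\<^sub>M k\<in>UNIV. borel)"
proof (rule measurable_PiM_single')
  show "(\<lambda>u. coarsen n m u k) \<in> borel_measurable (\<Pi>\<^sub>M k\<in>UNIV. borel :: 'a measure)" for k
    unfolding coarsen_def by measurable
qed (simp add: PiE_iff)

lemma dyadic_increments_coarsen:
  fixes w :: "real \<Rightarrow> 'a::ab_group_add"
  assumes "n \<le> m"
  shows "dyadic_increments \<delta> w n = coarsen n m (dyadic_increments \<delta> w m)"
proof
  fix k
  define f where "f j = w (dyadic_time \<delta> (m, k * 2 ^ (m - n) + j))" for j
  have p: "(2::real) ^ m = 2 ^ n * 2 ^ (m - n)"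
    using assms by (simp flip: power_add)
  have "coarsen n m (dyadic_increments \<delta> w m) k = (\<Sum>j<2 ^ (m - n). f (Suc j) - f j)"
    by (simp add: coarsen_def dyadic_increments_def f_def)
  also have "\<dots> = f (2 ^ (m - n)) - f 0"
    by (rule sum_lessThan_telescope)
  also have "\<dots> = dyadic_increments \<delta> w n k"
  proof -
    have "dyadic_time \<delta> (m, k * 2 ^ (m - n) + 2 ^ (m - n)) = dyadic_time \<delta> (n, Suc k)"
      and "dyadic_time \<delta> (m, k * 2 ^ (m - n)) = dyadic_time \<delta> (n, k)"
      by (simp_all add: dyadic_time_def p field_simps)
    then show ?thesis
      by (simp add: f_def dyadic_increments_def)
  qed
  finally show "dyadic_increments \<delta> w n k = coarsen n m (dyadic_increments \<delta> w m) k" ..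
qed

text \<open>Step \<open>2 ^ n\<close> of level \<open>n\<close> is at the time \<open>\<delta>\<close> on every level, so
  no coarse increment straddles the point of concatenation.\<close>

lemma comb_seq_coarsen:
  assumes "n \<le> m"
  shows "comb_seq (2 ^ n) (coarsen n m u) (coarsen n m v) = coarsen n m (comb_seq (2 ^ m) u v)"
proof
  fix k
  have p: "(2::nat) ^ m = 2 ^ n * 2 ^ (m - n)"
    using assms by (simp flip: power_add)
  show "comb_seq (2 ^ n) (coarsen n m u) (coarsen n m v) k = coarsen n m (comb_seq (2 ^ m) u v) k"
  proof (cases "k < 2 ^ n")
    case True
    have "k * 2 ^ (m - n) + j < 2 ^ m" if "j < 2 ^ (m - n)" for j
    proof -
      have "k * 2 ^ (m - n) + j < Suc k * 2 ^ (m - n)"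
        using that by simp
      also have "\<dots> \<le> 2 ^ m"
        unfolding p using True by (intro mult_right_mono) auto
      finally show ?thesis .
    qed
    with True show ?thesis
      by (simp add: comb_seq_def coarsen_def)
  next
    case False
    then obtain l where k: "k = l + 2 ^ n"
      by (metis add.commute le_add_diff_inverse not_less)
    have "k * 2 ^ (m - n) + j = (l * 2 ^ (m - n) + j) + 2 ^ m" for j
      by (simp add: k p algebra_simps)
    then have "comb_seq (2 ^ m) u v (k * 2 ^ (m - n) + j) = v (l * 2 ^ (m - n) + j)" for j
      by (simp only: comb_seq_add)
    then show ?thesis
      by (simp add: k comb_seq_add coarsen_def)
  qed
qed

lemma measurable_dyadic_increments [measurable]:
  fixes W :: "real \<Rightarrow> 'w \<Rightarrow> 'a::euclidean_space"
  assumes "brownian_motion M W" "0 < \<delta>"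
  shows "(\<lambda>\<omega>. dyadic_increments \<delta> (\<lambda>t. W t \<omega>)) \<in> M \<rightarrow>\<^sub>M increment_space"
proof -
  have "W (dyadic_time \<delta> i) \<in> borel_measurable M" for i
    using assms by (auto simp: brownian_motion_def dyadic_time_def split: prod.split)
  then have "(\<lambda>\<omega>. dyadic_increments \<delta> (\<lambda>t. W t \<omega>) n k) \<in> borel_measurable M" for n k
    by (simp add: dyadic_increments_def)
  then show ?thesis
    by (intro measurable_PiM_single') (auto simp: PiE_iff space_PiM)
qed

lemma dyadic_increments_iid:
  fixes W :: "real \<Rightarrow> 'w \<Rightarrow> 'a::euclidean_space"
  assumes W: "brownian_motion M W" and \<delta>: "0 < \<delta>"
  shows "\<exists>\<mu>. prob_space \<mu> \<and> sets \<mu> = sets borel \<and>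
    distr M (\<Pi>\<^sub>M k\<in>UNIV. borel) (\<lambda>\<omega>. dyadic_increments \<delta> (\<lambda>t. W t \<omega>) n) = (\<Pi>\<^sub>M k\<in>UNIV. \<mu>)"
proof -
  interpret prob_space M
    using W by (simp add: brownian_motion_def)
  define t where "t k = dyadic_time \<delta> (n, k)" for k
  have t: "0 \<le> t k" "t k < t (Suc k)" "t (Suc k) - t k = \<delta> / 2 ^ n" for k
    using \<delta> by (auto simp: t_def dyadic_time_def field_simps)
  define \<xi> where "\<xi> k \<omega> = W (t (Suc k)) \<omega> - W (t k) \<omega>" for k \<omega>
  have [measurable]: "W (t k) \<in> borel_measurable M" for k
    using W t(1) by (simp add: brownian_motion_def)
  have [measurable]: "\<xi> k \<in> borel_measurable M" for k
    unfolding \<xi>_def by measurable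
  define \<mu> where "\<mu> = distr M borel (\<xi> 0)"
  have law: "distr M borel (\<xi> k) =
      density lborel (\<lambda>x. ennreal (\<Prod>b\<in>Basis. normal_density 0 (sqrt (\<delta> / 2 ^ n)) (x \<bullet> b)))" for k
  proof -
    have "distributed M lborel (\<xi> k)
        (\<lambda>x. ennreal (\<Prod>b\<in>Basis. normal_density 0 (sqrt (\<delta> / 2 ^ n)) (x \<bullet> b)))"
      using W t(1,2)[of k] unfolding \<xi>_def brownian_motion_def t(3)[of k, symmetric] by blast
    then have "distr M lborel (\<xi> k) =
        density lborel (\<lambda>x. ennreal (\<Prod>b\<in>Basis. normal_density 0 (sqrt (\<delta> / 2 ^ n)) (x \<bullet> b)))"
      by (rule distributed_distr_eq_density)
    moreover have "distr M lborel (\<xi> k) = distr M borel (\<xi> k)"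
      by (intro distr_cong) auto
    ultimately show ?thesis by simp
  qed
  have "incseq t"
    using t(2) by (intro incseq_SucI less_imp_le)
  then have "indep_vars (\<lambda>_. borel) \<xi> UNIV"
    using W t(1)[of 0] unfolding \<xi>_def brownian_motion_def by blast
  then have "distr M (\<Pi>\<^sub>M k\<in>UNIV. borel) (\<lambda>\<omega>. \<lambda>k\<in>UNIV. \<xi> k \<omega>) =
      (\<Pi>\<^sub>M k\<in>UNIV. distr M borel (\<xi> k))"
    by (subst (asm) indep_vars_iff_distr_eq_PiM) auto
  moreover have "distr M borel (\<xi> k) = \<mu>" for k
    unfolding \<mu>_def law ..
  moreover have "(\<lambda>k\<in>UNIV. \<xi> k \<omega>) = dyadic_increments \<delta> (\<lambda>t. W t \<omega>) n" for \<omega>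
    by (simp add: fun_eq_iff \<xi>_def dyadic_increments_def t_def)
  ultimately have "distr M (\<Pi>\<^sub>M k\<in>UNIV. borel) (\<lambda>\<omega>. dyadic_increments \<delta> (\<lambda>t. W t \<omega>) n) = (\<Pi>\<^sub>M k\<in>UNIV. \<mu>)"
    by simp
  moreover have "prob_space \<mu>" "sets \<mu> = sets borel"
    unfolding \<mu>_def by (auto intro: prob_space_distr)
  ultimately show ?thesis by blast
qed

text \<open>Following one Brownian path up to time \<open>\<delta>\<close> and an independent one from then on
  produces a Brownian path. On a single level this says that splicing two independent i.i.d.
  sequences gives an i.i.d. sequence.\<close>

lemma brownian_concatenation:
  fixes W :: "real \<Rightarrow> 'w \<Rightarrow> 'a::euclidean_space" and \<delta> :: real
  defines "\<xi> \<equiv> \<lambda>\<omega>. dyadic_increments \<delta> (\<lambda>t. W t \<omega>)"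
  assumes W: "brownian_motion M W" and \<delta>: "0 < \<delta>"
  shows "distr M increment_space \<xi> =
    distr (M \<Otimes>\<^sub>M M) increment_space (\<lambda>(\<omega>, \<omega>') n. comb_seq (2 ^ n) (\<xi> \<omega> n) (\<xi> \<omega>' n))"
proof (rule distr_eq_if_levels_refine[where C = coarsen])
  interpret prob_space M
    using W by (simp add: brownian_motion_def)
  interpret pair_prob_space M M ..
  have [measurable]: "\<xi> \<in> M \<rightarrow>\<^sub>M increment_space"
    unfolding \<xi>_def using W \<delta> by (rule measurable_dyadic_increments)
  show "\<xi> \<in> M \<rightarrow>\<^sub>M increment_space" by measurable
  have [measurable]: "(\<lambda>\<omega>. \<xi> \<omega> n) \<in> M \<rightarrow>\<^sub>M (\<Pi>\<^sub>M k\<in>UNIV. borel)" for n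
    by measurable
  show "(\<lambda>(\<omega>, \<omega>') n. comb_seq (2 ^ n) (\<xi> \<omega> n) (\<xi> \<omega>' n)) \<in> M \<Otimes>\<^sub>M M \<rightarrow>\<^sub>M increment_space"
    unfolding split_beta'
    by (rule measurable_PiM_single', measurable) (simp add: PiE_iff space_PiM)
  show "prob_space M"
    using W by (simp add: brownian_motion_def)
  show "coarsen n m \<in> (\<Pi>\<^sub>M k\<in>UNIV. borel) \<rightarrow>\<^sub>M (\<Pi>\<^sub>M k\<in>UNIV. borel :: 'a measure)" for n m
    by measurable
  show \<xi>_coarsen: "\<xi> \<omega> n = coarsen n m (\<xi> \<omega> m)" if "n \<le> m" for n m \<omega>
    unfolding \<xi>_def using that by (rule dyadic_increments_coarsen)
  show "(\<lambda>(\<omega>, \<omega>') n. comb_seq (2 ^ n) (\<xi> \<omega> n) (\<xi> \<omega>' n)) p n =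
      coarsen n m ((\<lambda>(\<omega>, \<omega>') n. comb_seq (2 ^ n) (\<xi> \<omega> n) (\<xi> \<omega>' n)) p m)" if "n \<le> m" for n m p
    using that by (simp add: split_beta' \<xi>_coarsen[OF that] comb_seq_coarsen)
  fix n
  let ?S = "\<Pi>\<^sub>M k\<in>(UNIV::nat set). borel :: 'a measure"
  obtain \<mu> where \<mu>: "prob_space \<mu>" "sets \<mu> = sets borel"
      and law: "distr M ?S (\<lambda>\<omega>. \<xi> \<omega> n) = (\<Pi>\<^sub>M k\<in>UNIV. \<mu>)"
    using dyadic_increments_iid[OF W \<delta>] unfolding \<xi>_def by blast
  interpret \<mu>: prob_space \<mu> by fact
  interpret \<mu>: sequence_space \<mu> ..
  have "prob_space (distr M ?S (\<lambda>\<omega>. \<xi> \<omega> n))"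
    unfolding law using \<mu>(1) by (intro prob_space_PiM)
  then have fin: "sigma_finite_measure (distr M ?S (\<lambda>\<omega>. \<xi> \<omega> n))"
    by (rule prob_space_imp_sigma_finite)
  \<comment> \<open>the sets of the product depend on \<open>\<mu>\<close> only through \<open>sets \<mu>\<close>, so
      \<open>\<mu>.S\<close> and \<open>?S\<close> are interchangeable as target spaces\<close>
  have sets_S: "sets \<mu>.S = sets ?S"
    using \<mu>(2) by (intro sets_PiM_cong) auto
  have "distr (M \<Otimes>\<^sub>M M) ?S (\<lambda>(\<omega>, \<omega>'). comb_seq (2 ^ n) (\<xi> \<omega> n) (\<xi> \<omega>' n)) =
      distr (distr (M \<Otimes>\<^sub>M M) (?S \<Otimes>\<^sub>M ?S) (\<lambda>(\<omega>, \<omega>'). (\<xi> \<omega> n, \<xi> \<omega>' n))) ?S (\<lambda>(u, v). comb_seq (2 ^ n) u v)"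
    by (subst distr_distr) (auto simp: split_beta' comp_def)
  also have "distr (M \<Otimes>\<^sub>M M) (?S \<Otimes>\<^sub>M ?S) (\<lambda>(\<omega>, \<omega>'). (\<xi> \<omega> n, \<xi> \<omega>' n)) = \<mu>.S \<Otimes>\<^sub>M \<mu>.S"
    unfolding law[symmetric]
    by (rule pair_measure_distr[symmetric, OF _ _ fin]) measurable
  also have "distr (\<mu>.S \<Otimes>\<^sub>M \<mu>.S) ?S (\<lambda>(u, v). comb_seq (2 ^ n) u v) =
      distr (\<mu>.S \<Otimes>\<^sub>M \<mu>.S) \<mu>.S (\<lambda>(u, v). comb_seq (2 ^ n) u v)"
    using sets_S by (intro distr_cong) auto
  also have "\<dots> = \<mu>.S"
    by (rule \<mu>.PiM_comb_seq)
  finally show "distr M ?S (\<lambda>\<omega>. \<xi> \<omega> n) =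
      distr (M \<Otimes>\<^sub>M M) ?S (\<lambda>p. (\<lambda>(\<omega>, \<omega>') n. comb_seq (2 ^ n) (\<xi> \<omega> n) (\<xi> \<omega>' n)) p n)"
    unfolding law by (simp add: split_beta')
qed

text \<open>Conditioning on the increments before \<open>\<delta>\<close>: the future increments \<open>\<xi> \<omega> n (k + 2 ^ n)\<close>
  may be replaced by a fresh copy of the whole sequence.\<close>

lemma brownian_simple_markov:
  fixes W :: "real \<Rightarrow> 'w \<Rightarrow> 'a::euclidean_space" and \<delta> :: real
  defines "\<xi> \<equiv> \<lambda>\<omega>. dyadic_increments \<delta> (\<lambda>t. W t \<omega>)"
  assumes W: "brownian_motion M W" and \<delta>: "0 < \<delta>"
    and Z[measurable]: "Z \<in> increment_space \<rightarrow>\<^sub>M K"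
    and past: "\<And>u v. (\<And>n k. k < 2 ^ n \<Longrightarrow> u n k = v n k) \<Longrightarrow> Z u = Z v"
    and F[measurable]: "Measurable.pred (K \<Otimes>\<^sub>M increment_space) F"
  shows "measure M {\<omega> \<in> space M. F (Z (\<xi> \<omega>), \<lambda>n k. \<xi> \<omega> n (k + 2 ^ n))} =
    (\<integral>\<omega>. measure M {\<omega>' \<in> space M. F (Z (\<xi> \<omega>), \<xi> \<omega>')} \<partial>M)"
proof -
  interpret prob_space M
    using W by (simp add: brownian_motion_def)
  note M_sigma_finite = sigma_finite_measure_axioms and M_finite = emeasure_eq_measure
  interpret pair_prob_space M M ..
  have \<xi>[measurable]: "\<xi> \<in> M \<rightarrow>\<^sub>M increment_space"
    unfolding \<xi>_def using W \<delta> by (rule measurable_dyadic_increments)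
  define fut where "fut u = (\<lambda>n k. u n (k + 2 ^ n))" for u :: "nat \<Rightarrow> nat \<Rightarrow> 'a"
  have [measurable]: "fut \<in> increment_space \<rightarrow>\<^sub>M increment_space"
    unfolding fut_def by (intro measurable_PiM_single') (auto simp: PiE_iff space_PiM)
  define comb where "comb = (\<lambda>(\<omega>, \<omega>') n. comb_seq (2 ^ n) (\<xi> \<omega> n) (\<xi> \<omega>' n))"
  have [measurable]: "comb \<in> M \<Otimes>\<^sub>M M \<rightarrow>\<^sub>M increment_space"
    unfolding comb_def split_beta'
    by (rule measurable_PiM_single', measurable) (simp add: PiE_iff space_PiM)
  have Z_comb: "Z (comb (\<omega>, \<omega>')) = Z (\<xi> \<omega>)" and fut_comb: "fut (comb (\<omega>, \<omega>')) = \<xi> \<omega>'" for \<omega> \<omega>'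
    by (auto intro!: past simp: comb_def comb_seq_less fut_def comb_seq_add)
  define E where "E = {u \<in> space increment_space. F (Z u, fut u)}"
  have [measurable]: "E \<in> sets increment_space"
    unfolding E_def by measurable
  have "\<xi> -` E \<inter> space M = {\<omega> \<in> space M. F (Z (\<xi> \<omega>), fut (\<xi> \<omega>))}"
    using measurable_space[OF \<xi>] by (auto simp: E_def)
  then have "measure M {\<omega> \<in> space M. F (Z (\<xi> \<omega>), fut (\<xi> \<omega>))} = measure (distr M increment_space \<xi>) E"
    by (simp add: measure_distr)
  also have "\<dots> = measure (distr (M \<Otimes>\<^sub>M M) increment_space comb) E"
    using brownian_concatenation[OF W \<delta>] unfolding \<xi>_def comb_def by simp
  also have "\<dots> = measure (M \<Otimes>\<^sub>M M) {p \<in> space (M \<Otimes>\<^sub>M M). F (Z (\<xi> (fst p)), \<xi> (snd p))}"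
  proof -
    have "comb -` E \<inter> space (M \<Otimes>\<^sub>M M) =
        {p \<in> space (M \<Otimes>\<^sub>M M). F (Z (\<xi> (fst p)), \<xi> (snd p))}"
      by (auto simp: E_def space_PiM Z_comb fut_comb)
    then show ?thesis
      by (simp add: measure_distr)
  qed
  also have "\<dots> = (\<integral>\<omega>. measure M (Pair \<omega> -` {p \<in> space (M \<Otimes>\<^sub>M M). F (Z (\<xi> (fst p)), \<xi> (snd p))}) \<partial>M)"
    (is "measure (M \<Otimes>\<^sub>M M) ?E = _")
  proof -
    have E[measurable]: "?E \<in> sets (M \<Otimes>\<^sub>M M)" by measurable
    have "(\<lambda>\<omega>. measure M (Pair \<omega> -` ?E)) \<in> borel_measurable M"
      unfolding measure_def using sigma_finite_measure.measurable_emeasure_Pair[OF M_sigma_finite E] by measurable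
    then have "(\<integral>\<omega>. measure M (Pair \<omega> -` ?E) \<partial>M) = enn2real (\<integral>\<^sup>+\<omega>. emeasure M (Pair \<omega> -` ?E) \<partial>M)"
      by (subst integral_eq_nn_integral) (auto simp: M_finite)
    then show ?thesis
      by (simp add: measure_def sigma_finite_measure.emeasure_pair_measure_alt[OF M_sigma_finite E])
  qed
  also have "\<dots> = (\<integral>\<omega>. measure M {\<omega>' \<in> space M. F (Z (\<xi> \<omega>), \<xi> \<omega>')} \<partial>M)"
    by (intro Bochner_Integration.integral_cong refl arg_cong[where f = "measure M"]) (auto simp: space_pair_measure)
  finally show ?thesis
    by (simp add: fut_def)
qed

section \<open>Hitting times of open sets along dyadic times\<close>

lemma le_hitting_time_iff:
  "ereal u \<le> hitting_time S y \<longleftrightarrow> (\<forall>s. 0 \<le> s \<and> s < u \<longrightarrow> y s \<notin> S)"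
  by (force simp: hitting_time_def le_Inf_iff)

lemma hitting_time_less_iff:
  "hitting_time B y < hitting_time A y \<longleftrightarrow>
     (\<exists>t u. 0 \<le> t \<and> t < u \<and> y t \<in> B \<and> (\<forall>s. 0 \<le> s \<and> s < u \<longrightarrow> y s \<notin> A))"
proof
  assume "hitting_time B y < hitting_time A y"
  then obtain t where t: "0 \<le> t" "y t \<in> B" "ereal t < hitting_time A y"
    by (auto simp: hitting_time_def[of B] Inf_less_iff)
  then obtain u where "ereal t < ereal u" "ereal u < hitting_time A y"
    using ereal_dense2 by blast
  with t show "\<exists>t u. 0 \<le> t \<and> t < u \<and> y t \<in> B \<and> (\<forall>s. 0 \<le> s \<and> s < u \<longrightarrow> y s \<notin> A)"
    using le_hitting_time_iff[of u A y] by auto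
next
  assume "\<exists>t u. 0 \<le> t \<and> t < u \<and> y t \<in> B \<and> (\<forall>s. 0 \<le> s \<and> s < u \<longrightarrow> y s \<notin> A)"
  then obtain t u where t: "0 \<le> t" "t < u" "y t \<in> B" and u: "ereal u \<le> hitting_time A y"
    by (auto simp: le_hitting_time_iff)
  have "hitting_time B y \<le> ereal t"
    unfolding hitting_time_def using t by (intro Inf_lower) auto
  also have "\<dots> < ereal u" using t by simp
  also note u
  finally show "hitting_time B y < hitting_time A y" .
qed

lemma hitting_time_less_shift:
  assumes "0 \<le> a" and free: "\<And>s. 0 \<le> s \<Longrightarrow> s < a \<Longrightarrow> y s \<notin> A \<union> B"
  shows "hitting_time B y < hitting_time A y \<longleftrightarrow>
    hitting_time B (\<lambda>t. y (a + t)) < hitting_time A (\<lambda>t. y (a + t))"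
  unfolding hitting_time_less_iff
proof (intro iffI; elim exE conjE)
  fix t u assume *: "0 \<le> t" "t < u" "y t \<in> B" "\<forall>s. 0 \<le> s \<and> s < u \<longrightarrow> y s \<notin> A"
  then have "a \<le> t" using free[of t] by force
  then show "\<exists>t u. 0 \<le> t \<and> t < u \<and> y (a + t) \<in> B \<and> (\<forall>s. 0 \<le> s \<and> s < u \<longrightarrow> y (a + s) \<notin> A)"
    using * assms(1) by (intro exI[of _ "t - a"] exI[of _ "u - a"]) auto
next
  fix t u
  assume *: "0 \<le> t" "t < u" "y (a + t) \<in> B" "\<forall>s. 0 \<le> s \<and> s < u \<longrightarrow> y (a + s) \<notin> A"
  have "y s \<notin> A" if "0 \<le> s" "s < a + u" for s
    using free[of s] *(4)[rule_format, of "s - a"] that by (cases "s < a") auto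
  then show "\<exists>t u. 0 \<le> t \<and> t < u \<and> y t \<in> B \<and> (\<forall>s. 0 \<le> s \<and> s < u \<longrightarrow> y s \<notin> A)"
    using * assms(1) by (intro exI[of _ "a + t"] exI[of _ "a + u"]) auto
qed

lemma dyadic_time_dense:
  assumes "0 < \<delta>" "0 \<le> a" "a < b"
  shows "\<exists>i. a < dyadic_time \<delta> i \<and> dyadic_time \<delta> i < b"
proof -
  obtain m where "\<delta> / (b - a) < 2 ^ m"
    using real_arch_pow[of 2 "\<delta> / (b - a)"] by auto
  define h where "h = \<delta> / 2 ^ m"
  have h: "0 < h" "h < b - a"
    using assms \<open>\<delta> / (b - a) < 2 ^ m\<close> by (auto simp: h_def field_simps)
  define k where "k = nat (\<lfloor>a / h\<rfloor> + 1)"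
  have "0 \<le> a / h" using h assms by simp
  then have k: "real k = of_int \<lfloor>a / h\<rfloor> + 1"
    by (simp add: k_def)
  have "a / h < real k" "real k \<le> a / h + 1"
    unfolding k by linarith+
  then have "a < real k * h" "real k * h \<le> a + h"
    using h by (auto simp: field_simps)
  moreover have "dyadic_time \<delta> (m, k) = real k * h"
    by (simp add: dyadic_time_def h_def)
  ultimately show ?thesis
    using h by (intro exI[of _ "(m, k)"]) auto
qed

lemma open_set_nearby_times:
  fixes y :: "real \<Rightarrow> 'a::metric_space"
  assumes "continuous_on {0..} y" "open S" "0 \<le> s" "y s \<in> S"
  obtains e where "0 < e" "\<And>r. 0 \<le> r \<Longrightarrow> \<bar>r - s\<bar> < e \<Longrightarrow> y r \<in> S"
proof -
  obtain d where d: "0 < d" "ball (y s) d \<subseteq> S"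
    using assms openE by blast
  obtain e where "0 < e" "\<And>r. 0 \<le> r \<Longrightarrow> dist r s < e \<Longrightarrow> dist (y r) (y s) < d"
    using assms(1,3) d(1) unfolding continuous_on_iff by (metis atLeast_iff)
  then show thesis
    using d(2) that by (force simp: dist_real_def dist_commute subset_iff)
qed

lemma avoids_iff_dyadic:
  fixes y :: "real \<Rightarrow> 'a::metric_space"
  assumes "continuous_on {0..} y" "open S" "0 < \<delta>"
  shows "(\<forall>s. 0 \<le> s \<and> s < u \<longrightarrow> y s \<notin> S) \<longleftrightarrow>
    (\<forall>i. dyadic_time \<delta> i < u \<longrightarrow> y (dyadic_time \<delta> i) \<notin> S)"
proof (intro iffI allI impI)
  fix i assume *: "\<forall>s. 0 \<le> s \<and> s < u \<longrightarrow> y s \<notin> S" "dyadic_time \<delta> i < u"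
  have "0 \<le> dyadic_time \<delta> i"
    using assms(3) by (auto simp: dyadic_time_def split: prod.split)
  with * show "y (dyadic_time \<delta> i) \<notin> S" by blast
next
  fix s assume *: "\<forall>i. dyadic_time \<delta> i < u \<longrightarrow> y (dyadic_time \<delta> i) \<notin> S" "0 \<le> s \<and> s < u"
  show "y s \<notin> S"
  proof
    assume "y s \<in> S"
    then obtain e where e: "0 < e" "\<And>r. 0 \<le> r \<Longrightarrow> \<bar>r - s\<bar> < e \<Longrightarrow> y r \<in> S"
      using open_set_nearby_times assms * by metis
    obtain i where i: "s < dyadic_time \<delta> i" "dyadic_time \<delta> i < min (s + e) u"
      using dyadic_time_dense[of \<delta> s "min (s + e) u"] assms(3) e(1) * by auto
    then have "y (dyadic_time \<delta> i) \<in> S"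
      using * by (intro e(2)) auto
    moreover have "dyadic_time \<delta> i < u" using i by simp
    ultimately show False using *(1) by blast
  qed
qed

definition visits_before :: "('i \<Rightarrow> real) \<Rightarrow> 'a set \<Rightarrow> 'a set \<Rightarrow> ('i \<Rightarrow> 'a) \<Rightarrow> bool" where
  "visits_before T A B p \<longleftrightarrow>
     (\<exists>i j. T i < T j \<and> p i \<in> B \<and> (\<forall>l. T l < T j \<longrightarrow> p l \<notin> A))"

text \<open>A visit to an open set lasts for some time and so is seen at dyadic times. The stretch that
  avoids \<open>A\<close> has to extend strictly beyond the visit to \<open>B\<close>: for a path that starts in
  \<open>B\<close> on the frontier of \<open>A\<close> and enters \<open>A\<close> at once, both hitting times
  are \<open>0\<close>.\<close>

lemma hitting_time_less_iff_visits_before: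
  fixes y :: "real \<Rightarrow> 'a::metric_space"
  assumes y: "continuous_on {0..} y" and "open A" "open B" and \<delta>: "0 < \<delta>"
  shows "hitting_time B y < hitting_time A y \<longleftrightarrow>
    visits_before (dyadic_time \<delta>) A B (\<lambda>i. y (dyadic_time \<delta> i))"
proof -
  have avoid: "(\<forall>s. 0 \<le> s \<and> s < u \<longrightarrow> y s \<notin> A) \<longleftrightarrow>
      (\<forall>i. dyadic_time \<delta> i < u \<longrightarrow> y (dyadic_time \<delta> i) \<notin> A)" for u
    using avoids_iff_dyadic[OF y \<open>open A\<close> \<delta>] .
  have T: "0 \<le> dyadic_time \<delta> i" for i
    using \<delta> by (auto simp: dyadic_time_def split: prod.split)
  show ?thesis
    unfolding hitting_time_less_iff visits_before_def
  proof (intro iffI; elim exE conjE)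
    fix t u assume *: "0 \<le> t" "t < u" "y t \<in> B" "\<forall>s. 0 \<le> s \<and> s < u \<longrightarrow> y s \<notin> A"
    obtain e where e: "0 < e" "\<And>r. 0 \<le> r \<Longrightarrow> \<bar>r - t\<bar> < e \<Longrightarrow> y r \<in> B"
      using open_set_nearby_times[OF y \<open>open B\<close> *(1,3)] by blast
    obtain i where i: "t < dyadic_time \<delta> i" "dyadic_time \<delta> i < min (t + e) u"
      using dyadic_time_dense[OF \<delta> *(1), of "min (t + e) u"] e * by auto
    obtain j where j: "dyadic_time \<delta> i < dyadic_time \<delta> j" "dyadic_time \<delta> j < u"
      using dyadic_time_dense[OF \<delta> T, of i u] i by auto
    have "y (dyadic_time \<delta> i) \<in> B"
      using i T by (intro e(2)) auto
    moreover have "\<forall>l. dyadic_time \<delta> l < dyadic_time \<delta> j \<longrightarrow> y (dyadic_time \<delta> l) \<notin> A"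
      using *(4) j T by auto
    ultimately show "\<exists>i j. dyadic_time \<delta> i < dyadic_time \<delta> j \<and> y (dyadic_time \<delta> i) \<in> B \<and>
        (\<forall>l. dyadic_time \<delta> l < dyadic_time \<delta> j \<longrightarrow> y (dyadic_time \<delta> l) \<notin> A)"
      using j by blast
  next
    fix i j
    assume "dyadic_time \<delta> i < dyadic_time \<delta> j" "y (dyadic_time \<delta> i) \<in> B"
      "\<forall>l. dyadic_time \<delta> l < dyadic_time \<delta> j \<longrightarrow> y (dyadic_time \<delta> l) \<notin> A"
    then show "\<exists>t u. 0 \<le> t \<and> t < u \<and> y t \<in> B \<and> (\<forall>s. 0 \<le> s \<and> s < u \<longrightarrow> y s \<notin> A)"
      using T[of i] avoid by blast
  qed
qed

text \<open>At the hitting time of \<open>A \<union> B\<close> a path that starts outside is on the frontier of exactly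
  one of the two sets. Near that point it cannot meet the other one, so which frontier it is on
  decides which set is hit first.\<close>

lemma first_hit_frontier:
  fixes y :: "real \<Rightarrow> 'a::metric_space"
  assumes y: "continuous_on {0..} y" and A: "open A" and B: "open B"
    and y0: "y 0 \<notin> A \<union> B" and disj: "frontier A \<inter> frontier B = {}"
    and hit: "hitting_time (A \<union> B) y < ereal a"
  defines "\<tau> \<equiv> real_of_ereal (hitting_time (A \<union> B) y)"
  shows "(y \<tau> \<in> frontier B \<and> hitting_time B y < hitting_time A y) \<or>
    (y \<tau> \<in> frontier A \<and> \<not> hitting_time B y < hitting_time A y)"
proof -
  have nonneg: "ereal 0 \<le> hitting_time (A \<union> B) y"
    unfolding le_hitting_time_iff by auto
  then have \<tau>: "hitting_time (A \<union> B) y = ereal \<tau>"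
    using hit unfolding \<tau>_def by (cases "hitting_time (A \<union> B) y") auto
  have "0 \<le> \<tau>" using nonneg by (simp add: \<tau>)
  have before: "y s \<notin> A \<union> B" if "0 \<le> s" "s < \<tau>" for s
    using le_hitting_time_iff[of \<tau> "A \<union> B" y] that by (simp add: \<tau>)
  have after: "\<exists>s. \<tau> \<le> s \<and> s < u \<and> y s \<in> A \<union> B" if u: "\<tau> < u" for u
  proof -
    obtain s where "0 \<le> s" "s < u" "y s \<in> A \<union> B"
      using le_hitting_time_iff[of u "A \<union> B" y] u by (auto simp: \<tau>)
    moreover have "\<tau> \<le> s"
    proof (rule ccontr)
      assume "\<not> \<tau> \<le> s"
      then show False using before[of s] \<open>0 \<le> s\<close> \<open>y s \<in> A \<union> B\<close> by simp
    qed
    ultimately show ?thesis by blast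
  qed
  have out: "y \<tau> \<notin> A \<union> B"
  proof
    assume in_AB: "y \<tau> \<in> A \<union> B"
    then have "0 < \<tau>" using y0 \<open>0 \<le> \<tau>\<close> by (cases "\<tau> = 0") auto
    obtain e where e: "0 < e" "\<And>r. 0 \<le> r \<Longrightarrow> \<bar>r - \<tau>\<bar> < e \<Longrightarrow> y r \<in> A \<union> B"
      using open_set_nearby_times[OF y _ \<open>0 \<le> \<tau>\<close> in_AB] A B by blast
    define s where "s = max 0 (\<tau> - e / 2)"
    have "0 \<le> s" "s < \<tau>" "\<bar>s - \<tau>\<bar> < e"
      using e(1) \<open>0 < \<tau>\<close> by (auto simp: s_def)
    then show False using e(2) before by blast
  qed
  have "y \<tau> \<in> closure (A \<union> B)"
  proof (rule ccontr)
    assume "y \<tau> \<notin> closure (A \<union> B)"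
    then obtain e where "0 < e" "\<And>r. 0 \<le> r \<Longrightarrow> \<bar>r - \<tau>\<bar> < e \<Longrightarrow> y r \<in> - closure (A \<union> B)"
      using open_set_nearby_times[OF y _ \<open>0 \<le> \<tau>\<close>, of "- closure (A \<union> B)"] by (metis ComplI closed_closure open_Compl)
    moreover obtain s where "\<tau> \<le> s" "s < \<tau> + e" "y s \<in> A \<union> B"
      using after[of "\<tau> + e"] \<open>0 < e\<close> by auto
    ultimately show False
      using \<open>0 \<le> \<tau>\<close> closure_subset[of "A \<union> B"] by (auto simp: subset_iff)
  qed
  then have one_sided: "(y \<tau> \<in> frontier A \<and> y \<tau> \<notin> closure B) \<or> (y \<tau> \<in> frontier B \<and> y \<tau> \<notin> closure A)"
    using out disj A B by (auto simp: frontier_def interior_open)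
  have other: "\<exists>e>0. \<forall>s. \<tau> \<le> s \<and> s < \<tau> + e \<longrightarrow> y s \<notin> S" if S: "y \<tau> \<notin> closure S" for S
  proof -
    obtain e where "0 < e" "\<And>r. 0 \<le> r \<Longrightarrow> \<bar>r - \<tau>\<bar> < e \<Longrightarrow> y r \<in> - closure S"
      using open_set_nearby_times[OF y _ \<open>0 \<le> \<tau>\<close>, of "- closure S"] S by (metis ComplI closed_closure open_Compl)
    then show ?thesis
      using \<open>0 \<le> \<tau>\<close> closure_subset[of S] by (intro exI[of _ e]) (auto simp: subset_iff)
  qed
  from one_sided show ?thesis
  proof (elim disjE conjE)
    assume fr: "y \<tau> \<in> frontier A" and "y \<tau> \<notin> closure B"
    then obtain e where e: "0 < e" "\<And>s. \<tau> \<le> s \<Longrightarrow> s < \<tau> + e \<Longrightarrow> y s \<notin> B"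
      using other by blast
    obtain s where s: "\<tau> \<le> s" "s < \<tau> + e" "y s \<in> A"
      using after[of "\<tau> + e"] e by auto
    have "\<not> hitting_time B y < hitting_time A y"
      unfolding hitting_time_less_iff
    proof (intro notI, elim exE conjE)
      fix t u assume *: "0 \<le> t" "t < u" "y t \<in> B" "\<forall>s. 0 \<le> s \<and> s < u \<longrightarrow> y s \<notin> A"
      have "\<tau> + e \<le> t"
        using e(2)[of t] before[of t] * by force
      then show False using *(2,4) s \<open>0 \<le> \<tau>\<close> by auto
    qed
    with fr show ?thesis by blast
  next
    assume fr: "y \<tau> \<in> frontier B" and "y \<tau> \<notin> closure A"
    then obtain e where e: "0 < e" "\<And>s. \<tau> \<le> s \<Longrightarrow> s < \<tau> + e \<Longrightarrow> y s \<notin> A"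
      using other by blast
    obtain t where t: "\<tau> \<le> t" "t < \<tau> + e" "y t \<in> B"
      using after[of "\<tau> + e"] e by auto
    have "\<forall>s. 0 \<le> s \<and> s < \<tau> + e \<longrightarrow> y s \<notin> A"
      using e(2) before by (metis UnI1 not_less)
    then have "hitting_time B y < hitting_time A y"
      unfolding hitting_time_less_iff using t \<open>0 \<le> \<tau>\<close> by (metis order_trans)
    with fr show ?thesis by blast
  qed
qed

section \<open>The committor of the stopped process\<close>

lemma measurable_euler_scheme [measurable]:
  fixes G :: "'a::euclidean_space \<Rightarrow> 'a"
  assumes [measurable]: "G \<in> borel_measurable borel" "f \<in> borel_measurable N"
    "g \<in> N \<rightarrow>\<^sub>M increment_space"
  shows "(\<lambda>x. euler_scheme G c h (f x) (g x n) k) \<in> borel_measurable N"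
proof (induction k)
  case (Suc k)
  note [measurable] = this
  show ?case by simp
qed simp

lemma measurable_euler_limit [measurable]:
  fixes G :: "'a::euclidean_space \<Rightarrow> 'a"
  assumes [measurable]: "G \<in> borel_measurable borel" "f \<in> borel_measurable N"
    "g \<in> N \<rightarrow>\<^sub>M increment_space"
  shows "(\<lambda>x. euler_limit G c \<delta> (f x) (g x) i) \<in> borel_measurable N"
  unfolding euler_limit_def split_beta' by measurable

lemma pred_visits_before [measurable]:
  fixes T :: "'i::countable \<Rightarrow> real" and f :: "'b \<Rightarrow> 'i \<Rightarrow> 'a::topological_space"
  assumes [measurable]: "\<And>i. (\<lambda>x. f x i) \<in> borel_measurable N" and "open A" "open B"
  shows "Measurable.pred N (\<lambda>x. visits_before T A B (f x))"
proof -
  have [measurable]: "A \<in> sets borel" "B \<in> sets borel"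
    using assms by auto
  show ?thesis unfolding visits_before_def by measurable
qed

text \<open>Before \<open>\<delta>\<close> the path is a function of the past increments, and if it avoids
  \<open>A \<union> B\<close> until then, the event that \<open>B\<close> is hit first is decided by the path after
  \<open>\<delta>\<close>, which is driven by the future increments. With \<open>g\<close> the probability of that event
  as a function of the starting point, \<open>R\<close> is its conditional probability at time
  \<open>\<delta>\<close>, except that on the event of a hit before \<open>\<delta>\<close> it is left as it is.\<close>

lemma visit_probability_markov:
  fixes W Y :: "real \<Rightarrow> 'w \<Rightarrow> 'a::euclidean_space" and G :: "'a \<Rightarrow> 'a" and \<delta> c :: real
    and A B :: "'a set" and x :: 'a and M :: "'w measure"
  defines "\<xi> \<equiv> \<lambda>\<omega>. dyadic_increments \<delta> (\<lambda>t. W t \<omega>)"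
  defines "first_B \<equiv> \<lambda>z \<omega>. visits_before (dyadic_time \<delta>) A B (euler_limit G c \<delta> z (\<xi> \<omega>))"
  defines "g \<equiv> \<lambda>z. measure M {\<omega> \<in> space M. first_B z \<omega>}"
  defines "free \<equiv> \<lambda>u. \<forall>i. dyadic_time \<delta> i < \<delta> \<longrightarrow> euler_limit G c \<delta> x u i \<notin> A \<union> B"
  defines "R \<equiv> \<lambda>\<omega>. if free (\<xi> \<omega>) then g (euler_limit G c \<delta> x (\<xi> \<omega>) (0, 1)) else of_bool (first_B x \<omega>)"
  assumes W: "brownian_motion M W" and \<delta>: "0 < \<delta>" and G: "L-lipschitz_on UNIV G"
    and A: "open A" and B: "open B"
    and Y: "AE \<omega> in M. additive_noise_path G c (\<lambda>t. W t \<omega>) (\<lambda>t. Y t \<omega>) \<and> Y 0 \<omega> = x"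
  shows "R \<in> borel_measurable M" and "(\<integral>\<omega>. R \<omega> \<partial>M) = g x"
proof -
  interpret prob_space M
    using W by (simp add: brownian_motion_def)
  let ?T = "dyadic_time \<delta>" and ?e = "euler_limit G c \<delta>"
  have G_cont: "continuous_on UNIV G"
    using G lipschitz_on_continuous_on by blast
  have [measurable]: "G \<in> borel_measurable borel"
    using G_cont by (rule borel_measurable_continuous_onI)
  have [measurable]: "\<xi> \<in> M \<rightarrow>\<^sub>M increment_space"
    unfolding \<xi>_def using W \<delta> by (rule measurable_dyadic_increments)
  have [measurable]: "A \<in> sets borel" "B \<in> sets borel"
    using A B by auto
  have [measurable]: "Measurable.pred increment_space free"
    unfolding free_def by measurable
  define V where "V = (\<lambda>(z, u). visits_before ?T A B (?e z u))"
  have V[measurable]: "Measurable.pred (borel \<Otimes>\<^sub>M increment_space) V"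
    unfolding V_def split_beta' using A B by (intro pred_visits_before) measurable
  have first_B: "first_B z \<omega> \<longleftrightarrow> V (z, \<xi> \<omega>)" for z \<omega>
    by (simp add: first_B_def V_def)
  have [measurable]: "Measurable.pred M (first_B z)" for z
    unfolding first_B by measurable
  have [measurable]: "g \<in> borel_measurable borel"
  proof -
    let ?E = "{p \<in> space (borel \<Otimes>\<^sub>M M). V (fst p, \<xi> (snd p))}"
    have "?E \<in> sets (borel \<Otimes>\<^sub>M M)" by measurable
    then have "(\<lambda>z. measure M (Pair z -` ?E)) \<in> borel_measurable borel"
      unfolding measure_def using measurable_emeasure_Pair by measurable
    moreover have "Pair z -` ?E = {\<omega> \<in> space M. first_B z \<omega>}" for z
      by (auto simp: space_pair_measure first_B)
    ultimately show ?thesis by (simp add: g_def)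
  qed
  show "R \<in> borel_measurable M"
    unfolding R_def by measurable

  define fut where "fut \<omega> = (\<lambda>n k. \<xi> \<omega> n (k + 2 ^ n))" for \<omega>
  have [measurable]: "fut \<in> M \<rightarrow>\<^sub>M increment_space"
  proof -
    have "(\<lambda>u n k. u n (k + 2 ^ n)) \<in> increment_space \<rightarrow>\<^sub>M (increment_space :: (nat \<Rightarrow> nat \<Rightarrow> 'a) measure)"
      by (intro measurable_PiM_single') (auto simp: PiE_iff space_PiM)
    then show ?thesis unfolding fut_def by measurable
  qed
  have split: "AE \<omega> in M. free (\<xi> \<omega>) \<longrightarrow> (first_B x \<omega> \<longleftrightarrow> V (?e x (\<xi> \<omega>) (0, 1), fut \<omega>))"
    using Y
  proof (eventually_elim, intro impI)
    fix \<omega> assume *: "additive_noise_path G c (\<lambda>t. W t \<omega>) (\<lambda>t. Y t \<omega>) \<and> Y 0 \<omega> = x" and "free (\<xi> \<omega>)"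
    let ?y = "\<lambda>t. Y t \<omega>"
    have path: "?e x (\<xi> \<omega>) = (\<lambda>i. ?y (?T i))"
      using euler_limit_additive_noise_path[OF G conjunct1[OF *] \<delta>] * by (simp add: \<xi>_def fun_eq_iff)
    have shift: "additive_noise_path G c (\<lambda>t. W (\<delta> + t) \<omega>) (\<lambda>t. ?y (\<delta> + t))"
      using * \<delta> G_cont by (intro additive_noise_path_shift) auto
    have "dyadic_increments \<delta> (\<lambda>t. W (\<delta> + t) \<omega>) = fut \<omega>"
    proof (intro ext)
      fix n k
      have "?T (n, k + 2 ^ n) = \<delta> + ?T (n, k)" for k
        by (simp add: dyadic_time_def field_simps)
      from this[of k] this[of "Suc k"]
      show "dyadic_increments \<delta> (\<lambda>t. W (\<delta> + t) \<omega>) n k = fut \<omega> n k"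
        by (simp add: dyadic_increments_def fut_def \<xi>_def)
    qed
    then have path': "?e (?y \<delta>) (fut \<omega>) = (\<lambda>i. ?y (\<delta> + ?T i))"
      using euler_limit_additive_noise_path[OF G shift \<delta>] by (intro ext) simp
    have cont: "continuous_on {0..} ?y" "continuous_on {0..} (\<lambda>t. ?y (\<delta> + t))"
      using * shift by (simp_all add: additive_noise_path_def)
    have "\<forall>s. 0 \<le> s \<and> s < \<delta> \<longrightarrow> ?y s \<notin> A \<union> B"
      using \<open>free (\<xi> \<omega>)\<close> avoids_iff_dyadic[OF cont(1) _ \<delta>, of "A \<union> B" \<delta>] A B
      by (auto simp: free_def path)
    then have "hitting_time B ?y < hitting_time A ?y \<longleftrightarrow>
        hitting_time B (\<lambda>t. ?y (\<delta> + t)) < hitting_time A (\<lambda>t. ?y (\<delta> + t))"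
      using \<delta> by (intro hitting_time_less_shift) auto
    then have "first_B x \<omega> \<longleftrightarrow> V (?y \<delta>, fut \<omega>)"
      by (simp add: first_B_def V_def path path'
          hitting_time_less_iff_visits_before[OF cont(1) A B \<delta>]
          hitting_time_less_iff_visits_before[OF cont(2) A B \<delta>])
    moreover have "?e x (\<xi> \<omega>) (0, 1) = ?y \<delta>"
      by (simp add: path dyadic_time_def)
    ultimately show "first_B x \<omega> \<longleftrightarrow> V (?e x (\<xi> \<omega>) (0, 1), fut \<omega>)" by simp
  qed

  \<comment> \<open>\<open>Z\<close> is the information about the past that the decision needs; \<open>\<delta>\<close> is the dyadic
      time with index \<open>(0, 1)\<close>\<close>
  define Z where "Z u = (free u, ?e x u (0, 1))" for u
  have Z: "Z \<in> increment_space \<rightarrow>\<^sub>M count_space UNIV \<Otimes>\<^sub>M borel"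
    unfolding Z_def by measurable
  have past: "Z u = Z v" if "\<And>n k. k < 2 ^ n \<Longrightarrow> u n k = v n k" for u v
  proof -
    have "?e x u i = ?e x v i" if "?T i \<le> \<delta>" for i
      by (rule euler_limit_cong_past[OF _ that \<delta>]) fact
    moreover have "?T (0, 1) = \<delta>"
      by (simp add: dyadic_time_def)
    ultimately show ?thesis
      by (simp add: Z_def free_def)
  qed
  have F: "Measurable.pred ((count_space UNIV \<Otimes>\<^sub>M borel) \<Otimes>\<^sub>M increment_space)
      (\<lambda>(p, u). fst p \<and> V (snd p, u))"
    unfolding split_beta' by measurable
  have "prob {\<omega> \<in> space M. free (\<xi> \<omega>) \<and> V (?e x (\<xi> \<omega>) (0, 1), fut \<omega>)} =
      (\<integral>\<omega>. prob {\<omega>' \<in> space M. free (\<xi> \<omega>) \<and> first_B (?e x (\<xi> \<omega>) (0, 1)) \<omega>'} \<partial>M)"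
    using brownian_simple_markov[OF W \<delta> Z past F] by (simp add: Z_def fut_def first_B \<xi>_def)
  also have "\<dots> = (\<integral>\<omega>. (if free (\<xi> \<omega>) then g (?e x (\<xi> \<omega>) (0, 1)) else 0) \<partial>M)"
    by (intro Bochner_Integration.integral_cong) (auto simp: g_def)
  finally have markov: "prob {\<omega> \<in> space M. free (\<xi> \<omega>) \<and> V (?e x (\<xi> \<omega>) (0, 1), fut \<omega>)} =
      (\<integral>\<omega>. (if free (\<xi> \<omega>) then g (?e x (\<xi> \<omega>) (0, 1)) else 0) \<partial>M)" .
  have survive: "prob {\<omega> \<in> space M. free (\<xi> \<omega>) \<and> first_B x \<omega>} =
      prob {\<omega> \<in> space M. free (\<xi> \<omega>) \<and> V (?e x (\<xi> \<omega>) (0, 1), fut \<omega>)}"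
    by (rule measure_eq_AE) (use split in \<open>auto elim: eventually_mono\<close>)

  let ?exit = "{\<omega> \<in> space M. \<not> free (\<xi> \<omega>) \<and> first_B x \<omega>}"
  have "(\<integral>\<omega>. R \<omega> \<partial>M) =
      (\<integral>\<omega>. (if free (\<xi> \<omega>) then g (?e x (\<xi> \<omega>) (0, 1)) else 0) + indicator ?exit \<omega> \<partial>M)"
    by (intro Bochner_Integration.integral_cong) (auto simp: R_def)
  also have "\<dots> = (\<integral>\<omega>. (if free (\<xi> \<omega>) then g (?e x (\<xi> \<omega>) (0, 1)) else 0) \<partial>M) + prob ?exit"
  proof (subst Bochner_Integration.integral_add)
    show "integrable M (\<lambda>\<omega>. if free (\<xi> \<omega>) then g (?e x (\<xi> \<omega>) (0, 1)) else 0)"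
      by (rule integrable_const_bound[where B = 1]) (auto simp: g_def)
    show "integrable M (indicator ?exit :: 'w \<Rightarrow> real)"
      by (rule integrable_const_bound[where B = 1]) auto
  qed simp
  also have "\<dots> = prob {\<omega> \<in> space M. free (\<xi> \<omega>) \<and> first_B x \<omega>} + prob ?exit"
    unfolding survive markov ..
  also have "\<dots> = prob ({\<omega> \<in> space M. free (\<xi> \<omega>) \<and> first_B x \<omega>} \<union> ?exit)"
    by (intro finite_measure_Union[symmetric]) auto
  also have "{\<omega> \<in> space M. free (\<xi> \<omega>) \<and> first_B x \<omega>} \<union> ?exit = {\<omega> \<in> space M. first_B x \<omega>}"
    by auto
  finally show "(\<integral>\<omega>. R \<omega> \<partial>M) = g x"
    by (simp add: g_def)
qed

lemma langevin_solution_additive_noise_path: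
  assumes X: "langevin_solution V \<beta> \<Omega> M W x X" and W: "brownian_motion M W"
    and cont: "continuous_on UNIV (gradient V)"
  shows "AE \<omega> in M. additive_noise_path (gradient V) (sqrt (2 / \<beta>)) (\<lambda>t. W t \<omega>) (\<lambda>t. X t \<omega>) \<and>
    X 0 \<omega> = x \<and> (\<forall>t\<ge>0. X t \<omega> \<in> \<Omega>)"
proof -
  have "AE \<omega> in M. W 0 \<omega> = 0"
    using W by (simp add: brownian_motion_def)
  moreover have "AE \<omega> in M. continuous_on {0..} (\<lambda>t. X t \<omega>) \<and> (\<forall>t\<ge>0. X t \<omega> \<in> \<Omega> \<and>
      X t \<omega> = x - integral {0..t} (\<lambda>s. gradient V (X s \<omega>)) + sqrt (2 / \<beta>) *\<^sub>R W t \<omega>)"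
    using X by (simp add: langevin_solution_def)
  ultimately show ?thesis
  proof eventually_elim
    case (elim \<omega>)
    define I where "I t = integral {0..t} (\<lambda>s. gradient V (X s \<omega>))" for t
    have X_cont: "continuous_on {0..} (\<lambda>t. X t \<omega>)"
      and X_eq: "X t \<omega> = x - I t + sqrt (2 / \<beta>) *\<^sub>R W t \<omega>" if "0 \<le> t" for t
      using elim that by (auto simp: I_def)
    have drift: "continuous_on {0..} (\<lambda>t. gradient V (X t \<omega>))"
      by (rule continuous_on_compose2[OF cont]) (use elim in auto)
    have I_diff: "I t - I s = integral {s..t} (\<lambda>r. gradient V (X r \<omega>))" if "0 \<le> s" "s \<le> t" for s t
    proof -
      have "(\<lambda>r. gradient V (X r \<omega>)) integrable_on {0..t}"
        using that by (intro integrable_continuous_interval continuous_on_subset[OF drift]) auto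
      then have "I s + integral {s..t} (\<lambda>r. gradient V (X r \<omega>)) = I t"
        unfolding I_def by (rule Henstock_Kurzweil_Integration.integral_combine[OF that])
      then show ?thesis by (simp add: algebra_simps)
    qed
    have "X t \<omega> - X s \<omega> = sqrt (2 / \<beta>) *\<^sub>R (W t \<omega> - W s \<omega>) -
        integral {s..t} (\<lambda>r. gradient V (X r \<omega>))" if "0 \<le> s" "s \<le> t" for s t
      using X_eq[of s] X_eq[of t] that by (simp add: scaleR_diff_right flip: I_diff)
    moreover have "X 0 \<omega> = x"
      using X_eq[of 0] elim by (simp add: I_def)
    ultimately show ?case
      using elim unfolding additive_noise_path_def by blast
  qed
qed

text \<open>For the value of \<open>q\<close> at the stopped position: it agrees almost surely with a
  function of the noise increments that is measurable for \<open>M\<close> itself.\<close>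

lemma measurable_completion_AE_eq:
  assumes f: "f \<in> M \<rightarrow>\<^sub>M N" and eq: "AE \<omega> in M. g \<omega> = f \<omega>" and g: "g \<in> space M \<rightarrow> space N"
  shows "g \<in> completion M \<rightarrow>\<^sub>M N"
proof (rule measurableI)
  fix S assume S: "S \<in> sets N"
  show "g -` S \<inter> space (completion M) \<in> sets (completion M)"
  proof (rule completion.in_sets_AE)
    show "f -` S \<inter> space M \<in> sets (completion M)"
      using measurable_sets[OF f S] by simp
    show "AE \<omega> in completion M. \<omega> \<in> f -` S \<inter> space M \<longleftrightarrow> \<omega> \<in> g -` S \<inter> space (completion M)"
      using AE_completion[OF eq] by eventually_elim simp
  qed auto
qed (use g in auto)

theorem proposition1:
  fixes V :: "'a::euclidean_space \<Rightarrow> real"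
    and \<beta> \<delta> :: real
    and \<Omega> A B :: "'a set"
    and M :: "'w measure"
    and W :: "real \<Rightarrow> 'w \<Rightarrow> 'a"
    and X :: "'a \<Rightarrow> real \<Rightarrow> 'w \<Rightarrow> 'a"
    and q :: "'a \<Rightarrow> real"
  assumes "\<beta> > 0"
    and "smooth_on UNIV V"
    and "confining V"
    and "A \<subseteq> \<Omega>" and "B \<subseteq> \<Omega>"
    and "smooth_simply_connected_domain A"
    and "smooth_simply_connected_domain B"
    and "brownian_motion M W"
    and "\<And>x. x \<in> \<Omega> \<Longrightarrow> langevin_solution V \<beta> \<Omega> M W x (X x)"
    and "is_committor V \<beta> \<Omega> A B M X q"
    and "\<delta> > 0"
    and "bounded (range (gradient V))"
    and "\<exists>L. L-lipschitz_on UNIV (gradient V)"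
  shows "(\<forall>x\<in>\<Omega> - (A \<union> B). q x = stopped_semigroup M X A B \<delta> q x) \<and>
         (\<forall>x\<in>frontier A. q x = 0) \<and>
         (\<forall>x\<in>frontier B. q x = 1)"
proof (intro conjI)
  note W = \<open>brownian_motion M W\<close> and \<delta> = \<open>\<delta> > 0\<close>
  have A: "open A" and B: "open B"
    using assms(6,7) by (simp_all add: smooth_simply_connected_domain_def)
  show q_A: "\<forall>x\<in>frontier A. q x = 0" and q_B: "\<forall>x\<in>frontier B. q x = 1"
    using assms(10) by (simp_all add: is_committor_def solves_committor_equation_def)
  \<comment> \<open>the two boundary values of \<open>q\<close> exclude common frontier points\<close>
  then have disj: "frontier A \<inter> frontier B = {}" by force
  obtain L where G: "L-lipschitz_on UNIV (gradient V)"
    using assms(13) by blast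
  interpret prob_space M
    using W by (simp add: brownian_motion_def)
  let ?G = "gradient V" and ?c = "sqrt (2 / \<beta>)" and ?T = "dyadic_time \<delta>"
  let ?e = "euler_limit ?G ?c \<delta>"
  have G_cont: "continuous_on UNIV ?G"
    using G lipschitz_on_continuous_on by blast
  define \<xi> where "\<xi> \<omega> = dyadic_increments \<delta> (\<lambda>t. W t \<omega>)" for \<omega>
  define first_B where "first_B z \<omega> \<longleftrightarrow> visits_before ?T A B (?e z (\<xi> \<omega>))" for z \<omega>
  define g where "g z = measure M {\<omega> \<in> space M. first_B z \<omega>}" for z
  have path: "AE \<omega> in M. additive_noise_path ?G ?c (\<lambda>t. W t \<omega>) (\<lambda>t. X z t \<omega>) \<and>
      X z 0 \<omega> = z \<and> (\<forall>t\<ge>0. X z t \<omega> \<in> \<Omega>)" if "z \<in> \<Omega>" for z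
    using langevin_solution_additive_noise_path[OF assms(9)[OF that] W G_cont] .
  have euler: "?e z (\<xi> \<omega>) = (\<lambda>i. X z (?T i) \<omega>)"
    if "additive_noise_path ?G ?c (\<lambda>t. W t \<omega>) (\<lambda>t. X z t \<omega>)" "X z 0 \<omega> = z" for z \<omega>
    using euler_limit_additive_noise_path[OF G that(1) \<delta>] that(2) by (simp add: \<xi>_def fun_eq_iff)
  have first_B_iff: "first_B z \<omega> \<longleftrightarrow>
      hitting_time B (\<lambda>t. X z t \<omega>) < hitting_time A (\<lambda>t. X z t \<omega>)"
    if "additive_noise_path ?G ?c (\<lambda>t. W t \<omega>) (\<lambda>t. X z t \<omega>)" "X z 0 \<omega> = z" for z \<omega>
    using that(1) hitting_time_less_iff_visits_before[OF _ A B \<delta>, of "\<lambda>t. X z t \<omega>"]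
    by (simp add: first_B_def euler[OF that] additive_noise_path_def)
  \<comment> \<open>\<open>g\<close> extends \<open>q\<close> from \<open>\<Omega>\<close> to a Borel function on the whole
      space, which can be composed with the position at \<open>\<delta>\<close>\<close>
  have q_eq: "q z = g z" if "z \<in> \<Omega>" for z
  proof -
    have "?G \<in> borel_measurable borel" "\<xi> \<in> M \<rightarrow>\<^sub>M increment_space"
      using borel_measurable_continuous_onI[OF G_cont] measurable_dyadic_increments[OF W \<delta>]
      by (simp_all add: \<xi>_def[abs_def])
    then have meas: "{\<omega> \<in> space M. first_B z \<omega>} \<in> sets M"
      unfolding first_B_def using A B by measurable
    have ae: "AE \<omega> in completion M. \<omega> \<in> {\<omega> \<in> space M. first_B z \<omega>} \<longleftrightarrow>
        \<omega> \<in> {\<omega> \<in> space M. hitting_time B (\<lambda>t. X z t \<omega>) < hitting_time A (\<lambda>t. X z t \<omega>)}"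
      using AE_completion[OF path[OF that]] by eventually_elim (simp add: first_B_iff)
    have "{\<omega> \<in> space M. hitting_time B (\<lambda>t. X z t \<omega>) < hitting_time A (\<lambda>t. X z t \<omega>)}
        \<in> sets (completion M)"
      by (rule completion.in_sets_AE[OF ae]) (use meas in auto)
    then have "hitting_probability M X A B z = measure (completion M) {\<omega> \<in> space M. first_B z \<omega>}"
      unfolding hitting_probability_def using ae meas
      by (intro measure_eq_AE) (auto elim: eventually_mono)
    then show ?thesis
      using assms(10) that meas by (simp add: is_committor_def g_def)
  qed
  show "\<forall>x\<in>\<Omega> - (A \<union> B). q x = stopped_semigroup M X A B \<delta> q x"
  proof
    fix x assume x: "x \<in> \<Omega> - (A \<union> B)"
    define free where "free u \<longleftrightarrow> (\<forall>i. ?T i < \<delta> \<longrightarrow> ?e x u i \<notin> A \<union> B)" for u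
    define R where "R \<omega> = (if free (\<xi> \<omega>) then g (?e x (\<xi> \<omega>) (0, 1)) else of_bool (first_B x \<omega>))" for \<omega>
    define S where "S \<omega> = q (X x (real_of_ereal
        (min (hitting_time (A \<union> B) (\<lambda>t. X x t \<omega>)) (ereal \<delta>))) \<omega>)" for \<omega>
    have x_path: "AE \<omega> in M. additive_noise_path ?G ?c (\<lambda>t. W t \<omega>) (\<lambda>t. X x t \<omega>) \<and> X x 0 \<omega> = x"
      using path[of x] x by (auto elim: eventually_mono)
    have R: "R \<in> borel_measurable M" "(\<integral>\<omega>. R \<omega> \<partial>M) = g x"
      unfolding R_def[abs_def] free_def g_def first_B_def \<xi>_def
      by (rule visit_probability_markov[OF W \<delta> G A B x_path])+
    have "AE \<omega> in M. S \<omega> = R \<omega>"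
      using path[OF DiffD1[OF x]]
    proof eventually_elim
      case (elim \<omega>)
      let ?y = "\<lambda>t. X x t \<omega>" and ?\<tau> = "hitting_time (A \<union> B) (\<lambda>t. X x t \<omega>)"
      have cont: "continuous_on {0..} ?y"
        using elim by (simp add: additive_noise_path_def)
      have free: "free (\<xi> \<omega>) \<longleftrightarrow> ereal \<delta> \<le> ?\<tau>"
        unfolding le_hitting_time_iff free_def
        using avoids_iff_dyadic[OF cont _ \<delta>, of "A \<union> B" \<delta>] A B elim by (auto simp: euler)
      show "S \<omega> = R \<omega>"
      proof (cases "free (\<xi> \<omega>)")
        case True
        then have "S \<omega> = q (?y \<delta>)"
          using free by (simp add: S_def min_def)
        also have "\<dots> = g (?y \<delta>)"
          using elim \<delta> by (intro q_eq) auto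
        also have "?y \<delta> = ?e x (\<xi> \<omega>) (0, 1)"
          using elim by (simp add: euler dyadic_time_def)
        finally show ?thesis
          using True by (simp add: R_def)
      next
        case False
        then have hit: "?\<tau> < ereal \<delta>" using free by simp
        have "?y 0 \<notin> A \<union> B" using elim x by auto
        from first_hit_frontier[OF cont A B this disj hit] show ?thesis
          using False hit q_A q_B elim by (auto simp: S_def R_def min_def first_B_iff)
      qed
    qed
    then have "S \<in> borel_measurable (completion M)" and "AE \<omega> in completion M. S \<omega> = R \<omega>"
      using R(1) by (auto intro: measurable_completion_AE_eq AE_completion)
    then have "(\<integral>\<omega>. S \<omega> \<partial>completion M) = (\<integral>\<omega>. R \<omega> \<partial>completion M)"
      using R(1) by (intro integral_cong_AE) (auto intro: measurable_completion)
    also have "\<dots> = g x"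
      using R by (simp add: integral_completion)
    also have "\<dots> = q x"
      using x q_eq by simp
    finally show "q x = stopped_semigroup M X A B \<delta> q x"
      by (simp add: stopped_semigroup_def S_def)
  qed
qed

end
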